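(* Let $X$ be a regular topological space and let $\mathscr{O}$ be the collection of all open covers of $X$. If $X$ satisfies $\mathbf{S}^*_1(\mathscr{O},\mathscr{O})$, then $X$ satisfies $\mathbf{CS}_1(\mathscr{O},\mathscr{O})$.
   Context: Regular spaces are understood as in Engelking's "General Topology" (so $T_1$ is included). For a set $Y$, $[Y]^{<\omega}$ is the collection of all finite subsets of $Y$ (including $\emptyset$; $\bigcup\emptyset=\emptyset$). For $A\subseteq X$ and a family $\mathcal{U}$ of subsets of $X$, the star of $A$ with respect to $\mathcal{U}$ is $St(A,\mathcal{U})=\bigcup\{U\in\mathcal{U}:U\cap A\neq\emptyset\}$. Let $\mathscr{A},\mathscr{B}$ be collections of families of subsets of $X$. $\mathbf{S}^*_1(\mathscr{A},\mathscr{B})$: for any sequence $\{\mathcal{A}_n:n\in\omega\}$ of elements of $\mathscr{A}$ there is a sequence $\{B_n:n\in\omega\}$ such that $B_n\in\mathcal{A}_n$ for each $n\in\omega$, and $\{St(B_n,\mathcal{A}_n):n\in\omega\}\in\mathscr{B}$. $\mathbf{CS}_1(\mathscr{A},\mathscr{B})$: for any sequence $\{\mathcal{U}_n:n\in\omega\}$ of elements of $\mathscr{A}$ there is a sequence $\{U_n:n\in\omega\}$ such that $U_n\in\mathcal{U}_n$ for each $n\in\omega$, and $\bigcup\{\mathcal{V}_n:n\in\omega\}\in\mathscr{B}$, where $\mathcal{V}_n=\{\bigcup\mathcal{V}:\mathcal{V}\in[\mathcal{U}_n]^{<\omega}\text{ and }U_n\cap V\neq\emptyset\text{ for each }V\in\mathcal{V}\}$.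 *)

theory Defs
  imports "HOL-Analysis.Analysis"
begin

definition St :: "'a set \<Rightarrow> 'a set set \<Rightarrow> 'a set" where
  "St A \<U> = \<Union>{U \<in> \<U>. U \<inter> A \<noteq> {}}"

text \<open>The empty set is permitted as a member of a cover.\<close>

definition open_covers :: "'a topology \<Rightarrow> 'a set set set" where
  "open_covers X = {\<U>. (\<forall>U\<in>\<U>. openin X U) \<and> \<Union>\<U> = topspace X}"

text \<open>The ambient space enters the selection principles only through the collections
  \<open>\<A>\<close> and \<open>\<B>\<close>.\<close>

definition S1_star :: "'a set set set \<Rightarrow> 'a set set set \<Rightarrow> bool" where
  "S1_star \<A> \<B> \<longleftrightarrow>
    (\<forall>A :: nat \<Rightarrow> 'a set set. (\<forall>n. A n \<in> \<A>) \<longrightarrow>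
      (\<exists>B :: nat \<Rightarrow> 'a set. (\<forall>n. B n \<in> A n) \<and> {St (B n) (A n) |n. True} \<in> \<B>))"

definition CS1 :: "'a set set set \<Rightarrow> 'a set set set \<Rightarrow> bool" where
  "CS1 \<A> \<B> \<longleftrightarrow>
    (\<forall>\<U> :: nat \<Rightarrow> 'a set set. (\<forall>n. \<U> n \<in> \<A>) \<longrightarrow>
      (\<exists>U :: nat \<Rightarrow> 'a set. (\<forall>n. U n \<in> \<U> n) \<and>
        (\<Union>n. {\<Union>\<V> |\<V>. \<V> \<in> Fpow (\<U> n) \<and> (\<forall>V\<in>\<V>. U n \<inter> V \<noteq> {})}) \<in> \<B>))"

end

theory Submission
  imports Defs
begin

text \<open>For every choice of sets \<open>U n \<in> \<U> n\<close>, the family of finite unions that \<open>CS1\<close> requires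
  to be a cover has the same union as the family of stars \<open>St (U n) (\<U> n)\<close>: one-element
  subfamilies already exhaust the star. Its members are open, so it is an open cover whenever
  the stars cover the space, and a choice witnessing \<open>S1_star\<close> also witnesses \<open>CS1\<close>.\<close>

lemma Union_finite_unions_meeting_eq_St:
  "\<Union>{\<Union>\<V> |\<V>. \<V> \<in> Fpow \<U> \<and> (\<forall>V\<in>\<V>. A \<inter> V \<noteq> {})} = St A \<U>" (is "\<Union>?F = _")
proof
  show "\<Union>?F \<subseteq> St A \<U>"
    unfolding St_def Fpow_def by blast
  show "St A \<U> \<subseteq> \<Union>?F"
  proof
    fix x assume "x \<in> St A \<U>"
    then obtain V where V: "V \<in> \<U>" "V \<inter> A \<noteq> {}" "x \<in> V"
      by (auto simp: St_def)
    then have "\<Union>{V} \<in> ?F"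
      by (intro CollectI exI[of _ "{V}"]) (auto simp: Fpow_def)
    with \<open>x \<in> V\<close> show "x \<in> \<Union>?F"
      by auto
  qed
qed

theorem proposition2p3:
  fixes X :: "'a topology"
  assumes "regular_space X" and "t1_space X"
    and "S1_star (open_covers X) (open_covers X)"
  shows "CS1 (open_covers X) (open_covers X)"
  unfolding CS1_def
proof (intro allI impI)
  fix \<U> :: "nat \<Rightarrow> 'a set set"
  assume \<U>: "\<forall>n. \<U> n \<in> open_covers X"
  then obtain U where U: "\<forall>n. U n \<in> \<U> n"
    and cov: "{St (U n) (\<U> n) |n. True} \<in> open_covers X"
    using assms(3) unfolding S1_star_def by blast
  let ?F = "\<lambda>n. {\<Union>\<V> |\<V>. \<V> \<in> Fpow (\<U> n) \<and> (\<forall>V\<in>\<V>. U n \<inter> V \<noteq> {})}"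
  have "\<Union>(\<Union>n. ?F n) = (\<Union>n. \<Union>(?F n))"
    by blast
  also have "\<dots> = (\<Union>n. St (U n) (\<U> n))"
    by (simp only: Union_finite_unions_meeting_eq_St)
  also have "\<dots> = \<Union>{St (U n) (\<U> n) |n. True}"
    by blast
  also have "\<dots> = topspace X"
    using cov by (simp add: open_covers_def)
  finally have "\<Union>(\<Union>n. ?F n) = topspace X" .
  moreover have "\<forall>W\<in>(\<Union>n. ?F n). openin X W"
    using \<U> by (auto simp: open_covers_def Fpow_def intro!: openin_Union)
  ultimately have "(\<Union>n. ?F n) \<in> open_covers X"
    unfolding open_covers_def by blast
  with U show "\<exists>U. (\<forall>n. U n \<in> \<U> n) \<and>
      (\<Union>n. {\<Union>\<V> |\<V>. \<V> \<in> Fpow (\<U> n) \<and> (\<forall>V\<in>\<V>. U n \<inter> V \<noteq> {})}) \<in> open_covers X"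
    by blast
qed

end
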